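(* Let $d=3$ and consider the three-dimensional $(\lambda,\nu)$-quasilinear system $A^{0}(U)U_{t}+\sum_{i=1}^{3}A^{i}_{\lambda\nu}(U)\,\partial_{i}U+Q(U)=0$ described in the context. If there is $(\rho^{\ast},\theta^{\ast})\in\mathcal{D}$ such that $\lambda(\rho^{\ast},\theta^{\ast})+\nu(\rho^{\ast},\theta^{\ast})\neq 0$, then the $(\lambda,\nu)$-quasilinear system is not hyperbolic.
   Context: Standing assumptions. $\mathcal{D}:=\{(\rho,\theta)\in\mathbb{R}^{2}:\rho>0,\ \theta>0\}$. The pressure $p$, internal energy $e$ and thermal conductivity $\kappa$ are given smooth functions of $(\rho,\theta)\in\mathcal{D}$ such that $p,\,p_{\rho},\,p_{\theta},\,e_{\theta},\,\kappa>0$ on $\mathcal{D}$ (subscripts $\rho,\theta$ denote partial derivatives). $\lambda$ and $\nu$ are real-valued functions of $(\rho,\theta)\in\mathcal{D}$. $\tau>0$ is a constant (relaxation time). Three-dimensional system. The state variable is $U=(\rho,v,\theta,q)^{\top}\in\mathcal{O}:=\{(\rho,v,\theta,q)\in\mathbb{R}\times\mathbb{R}^{3}\times\mathbb{R}\times\mathbb{R}^{3}:\rho>0,\ \theta>0\}\subset\mathbb{R}^{8}$. All of $p,e,\kappa,\lambda,\nu$ and their derivatives are evaluated at $(\rho,\theta)$. $A^{0}(U)=\operatorname{diag}(1,\rho\mathbb{I}_{3},\rho e_{\theta},\tau\mathbb{I}_{3})$ and $Q(U)=(0,0,0,0,0,q_{1},q_{2},q_{3})^{\top}$. The matrices $A^{i}_{\lambda\nu}(U)$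 are determined by the symbol $A_{\lambda\nu}(\xi;U)=\sum_{i=1}^{3}A^{i}_{\lambda\nu}(U)\xi_{i}$, which in block form (blocks of sizes $1,3,1,3$, with $\xi$ a column vector) is $$A_{\lambda\nu}(\xi;U)=\begin{pmatrix}\xi\cdot v&\rho\,\xi^{\top}&0&0\\ p_{\rho}\,\xi&\rho(\xi\cdot v)\mathbb{I}_{3}&p_{\theta}\,\xi&0\\0&\theta p_{\theta}\,\xi^{\top}&\rho e_{\theta}\,\xi\cdot v&\xi^{\top}\\0&\tau\mathcal{Q}_{\lambda,\nu}(\xi;q)&\kappa\,\xi&\tau(\xi\cdot v)\mathbb{I}_{3}\end{pmatrix},$$ where, with $\gamma:=\lambda+\nu$, $\lambda^{+}:=\frac{\lambda}{2}+\frac12$, $\lambda^{-}:=\frac{\lambda}{2}-\frac12$, $$\mathcal{Q}_{\lambda,\nu}(\xi;q)=\begin{pmatrix}\gamma\xi_{1}q_{1}+\lambda^{-}(\xi_{2}q_{2}+\xi_{3}q_{3})&\lambda^{+}\xi_{1}q_{2}+\nu\xi_{2}q_{1}&\lambda^{+}\xi_{1}q_{3}+\nu\xi_{3}q_{1}\\ \lambda^{+}\xi_{2}q_{1}+\nu\xi_{1}q_{2}&\gamma\xi_{2}q_{2}+\lambda^{-}(\xi_{1}q_{1}+\xi_{3}q_{3})&\lambda^{+}\xi_{2}q_{3}+\nu\xi_{3}q_{2}\\ \lambda^{+}\xi_{3}q_{1}+\nu\xi_{1}q_{3}&\lambda^{+}\xi_{3}q_{2}+\nu\xi_{2}q_{3}&\gamma\xi_{3}q_{3}+\lambda^{-}(\xi_{1}q_{1}+\xi_{2}q_{2})\end{pmatrix}.$$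 Hyperbolicity. The system is called hyperbolic if for every fixed state $U\in\mathcal{O}$ and every $\xi\in\mathbb{S}^{2}$ the matrix $A^{0}(U)$ is nonsingular and the generalized eigenvalue problem $\left(A_{\lambda\nu}(\xi;U)-\eta A^{0}(U)\right)V=0$ has only real eigenvalues $\eta$ and $8$ linearly independent eigenvectors. *)

theory Defs
  imports "HOL-Analysis.Analysis"
begin

section \<open>Smooth functions and partial derivatives\<close>

text \<open>The class \<open>C\<^sup>k\<close> on an open set: continuity for \<open>k = 0\<close>, and for \<open>k + 1\<close> differentiability
  with all directional derivatives of class \<open>C\<^sup>k\<close>.  The derivatives are taken with respect to full
  neighbourhoods, so the notion is the intended one only for open \<open>S\<close>.\<close>

primrec Ck_on :: "nat \<Rightarrow> ('a::euclidean_space \<Rightarrow> real) \<Rightarrow> 'a set \<Rightarrow> bool" where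
  "Ck_on 0 f S \<longleftrightarrow> continuous_on S f"
| "Ck_on (Suc k) f S \<longleftrightarrow>
     (\<forall>x\<in>S. f differentiable (at x)) \<and> (\<forall>v. Ck_on k (\<lambda>x. frechet_derivative f (at x) v) S)"

definition smooth_on :: "('a::euclidean_space \<Rightarrow> real) \<Rightarrow> 'a set \<Rightarrow> bool" where
  "smooth_on f S \<longleftrightarrow> (\<forall>k. Ck_on k f S)"

definition d_rho :: "(real \<times> real \<Rightarrow> real) \<Rightarrow> real \<times> real \<Rightarrow> real" where
  "d_rho f = (\<lambda>(\<rho>, \<theta>). deriv (\<lambda>r. f (r, \<theta>)) \<rho>)"

definition d_theta :: "(real \<times> real \<Rightarrow> real) \<Rightarrow> real \<times> real \<Rightarrow> real" where
  "d_theta f = (\<lambda>(\<rho>, \<theta>). deriv (\<lambda>t. f (\<rho>, t)) \<theta>)"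

section \<open>States\<close>

definition thermo_domain :: "(real \<times> real) set" where
  "thermo_domain = {(\<rho>, \<theta>). \<rho> > 0 \<and> \<theta> > 0}"

type_synonym state = "real \<times> (real^3) \<times> real \<times> (real^3)"

definition state_domain :: "state set" where
  "state_domain = {(\<rho>, v, \<theta>, q). \<rho> > 0 \<and> \<theta> > 0}"

text \<open>The eight scalar components of a state \<open>(\<rho>, v, \<theta>, q)\<close>.  Vectors and matrices are indexed by
  this type instead of by \<open>1, \<dots>, 8\<close>, so that the block structure \<open>1 + 3 + 1 + 3\<close> stays visible.\<close>

datatype component = Density | Velocity 3 | Temperature | Flux 3

lemma UNIV_component:
  "UNIV = {Density, Temperature} \<union> range Velocity \<union> range Flux"
proof -
  have "c \<in> {Density, Temperature} \<union> range Velocity \<union> range Flux" for c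
    by (cases c) auto
  then show ?thesis by blast
qed

instance component :: finite
  by standard (simp add: UNIV_component)

lemma card_component: "CARD(component) = 8"
proof -
  have *: "card (range Velocity \<union> range Flux) = 6"
    by (subst card_Un_disjoint) (auto simp: card_image inj_on_def)
  show ?thesis
    unfolding UNIV_component Un_assoc insert_is_Un[symmetric] Un_insert_left Un_empty_left
    by (subst card_insert_disjoint; auto simp: * image_iff)+
qed

section \<open>Hyperbolic quasilinear systems\<close>

text \<open>The coefficients of a system
  \<open>A\<^sup>0(U) U\<^sub>t + (\<Sum>i. A\<^sup>i(U) \<partial>\<^sub>i U) + Q(U) = 0\<close> in three space dimensions.\<close>

record quasilinear_system =
  time_coeff :: "state \<Rightarrow> real^component^component"
  space_coeff :: "3 \<Rightarrow> state \<Rightarrow> real^component^component"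
  source :: "state \<Rightarrow> real^component"

definition symbol_of :: "quasilinear_system \<Rightarrow> real^3 \<Rightarrow> state \<Rightarrow> real^component^component" where
  "symbol_of S \<xi> U = (\<Sum>i\<in>UNIV. (\<xi> $ i) *\<^sub>R space_coeff S i U)"

text \<open>\<open>V\<close> is an eigenvector, for the eigenvalue \<open>\<eta>\<close>, of \<open>(A - \<eta> B) V = 0\<close>.\<close>

definition gen_eigenvector ::
  "complex^'n^'n \<Rightarrow> complex^'n^'n \<Rightarrow> complex \<Rightarrow> complex^'n::finite \<Rightarrow> bool" where
  "gen_eigenvector A B \<eta> V \<longleftrightarrow> V \<noteq> 0 \<and> (A - mat \<eta> ** B) *v V = 0"

definition hyperbolic :: "quasilinear_system \<Rightarrow> bool" where
  "hyperbolic S \<longleftrightarrow>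
    (\<forall>U\<in>state_domain. \<forall>\<xi>\<in>sphere 0 1.
      invertible (time_coeff S U) \<and>
      (let A = map_matrix complex_of_real (symbol_of S \<xi> U);
           B = map_matrix complex_of_real (time_coeff S U)
       in (\<forall>\<eta> V. gen_eigenvector A B \<eta> V \<longrightarrow> \<eta> \<in> \<real>) \<and>
          (\<exists>E. card E = 8 \<and> vec.independent E \<and> (\<forall>V\<in>E. \<exists>\<eta>. gen_eigenvector A B \<eta> V))))"

section \<open>The \<open>(\<lambda>,\<nu>)\<close>-quasilinear system\<close>

text \<open>In this section \<open>lam\<close> and \<open>nu\<close> stand for \<open>\<lambda>\<close> and \<open>\<nu>\<close>.\<close>

definition Q_matrix :: "real \<Rightarrow> real \<Rightarrow> real^3 \<Rightarrow> real^3 \<Rightarrow> real^3^3" where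
  "Q_matrix lam nu \<xi> q =
    (let g = lam + nu; lp = lam / 2 + 1 / 2; lm = lam / 2 - 1 / 2 in
     vector
      [vector [g * \<xi>$1 * q$1 + lm * (\<xi>$2 * q$2 + \<xi>$3 * q$3),
               lp * \<xi>$1 * q$2 + nu * \<xi>$2 * q$1,
               lp * \<xi>$1 * q$3 + nu * \<xi>$3 * q$1],
       vector [lp * \<xi>$2 * q$1 + nu * \<xi>$1 * q$2,
               g * \<xi>$2 * q$2 + lm * (\<xi>$1 * q$1 + \<xi>$3 * q$3),
               lp * \<xi>$2 * q$3 + nu * \<xi>$3 * q$2],
       vector [lp * \<xi>$3 * q$1 + nu * \<xi>$1 * q$3,
               lp * \<xi>$3 * q$2 + nu * \<xi>$2 * q$3,
               g * \<xi>$3 * q$3 + lm * (\<xi>$1 * q$1 + \<xi>$2 * q$2)]])"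

definition A0_matrix ::
  "(real \<times> real \<Rightarrow> real) \<Rightarrow> real \<Rightarrow> state \<Rightarrow> real^component^component" where
  "A0_matrix e \<tau> = (\<lambda>(\<rho>, v, \<theta>, q).
     \<chi> i j. if i = j
            then (case i of
                    Density \<Rightarrow> 1
                  | Velocity _ \<Rightarrow> \<rho>
                  | Temperature \<Rightarrow> \<rho> * d_theta e (\<rho>, \<theta>)
                  | Flux _ \<Rightarrow> \<tau>)
            else 0)"

text \<open>The symbol \<open>A\<^sub>\<lambda>\<^sub>\<nu>(\<xi>; U)\<close>: the outer case distinction selects the block row, the inner one the
  block column.\<close>

definition A_symbol ::
  "(real \<times> real \<Rightarrow> real) \<Rightarrow> (real \<times> real \<Rightarrow> real) \<Rightarrow> (real \<times> real \<Rightarrow> real) \<Rightarrow>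
   (real \<times> real \<Rightarrow> real) \<Rightarrow> (real \<times> real \<Rightarrow> real) \<Rightarrow> real \<Rightarrow>
   real^3 \<Rightarrow> state \<Rightarrow> real^component^component" where
  "A_symbol p e \<kappa> lam nu \<tau> \<xi> = (\<lambda>(\<rho>, v, \<theta>, q).
     \<chi> i j. case i of
       Density \<Rightarrow>
         (case j of
            Density \<Rightarrow> \<xi> \<bullet> v
          | Velocity l \<Rightarrow> \<rho> * \<xi> $ l
          | Temperature \<Rightarrow> 0
          | Flux l \<Rightarrow> 0)
     | Velocity k \<Rightarrow>
         (case j of
            Density \<Rightarrow> d_rho p (\<rho>, \<theta>) * \<xi> $ k
          | Velocity l \<Rightarrow> \<rho> * (\<xi> \<bullet> v) * mat 1 $ k $ l
          | Temperature \<Rightarrow> d_theta p (\<rho>, \<theta>) * \<xi> $ k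
          | Flux l \<Rightarrow> 0)
     | Temperature \<Rightarrow>
         (case j of
            Density \<Rightarrow> 0
          | Velocity l \<Rightarrow> \<theta> * d_theta p (\<rho>, \<theta>) * \<xi> $ l
          | Temperature \<Rightarrow> \<rho> * d_theta e (\<rho>, \<theta>) * (\<xi> \<bullet> v)
          | Flux l \<Rightarrow> \<xi> $ l)
     | Flux k \<Rightarrow>
         (case j of
            Density \<Rightarrow> 0
          | Velocity l \<Rightarrow> \<tau> * Q_matrix (lam (\<rho>, \<theta>)) (nu (\<rho>, \<theta>)) \<xi> q $ k $ l
          | Temperature \<Rightarrow> \<kappa> (\<rho>, \<theta>) * \<xi> $ k
          | Flux l \<Rightarrow> \<tau> * (\<xi> \<bullet> v) * mat 1 $ k $ l))"

text \<open>Since the symbol is linear in \<open>\<xi>\<close>, the coefficient matrix \<open>A\<^sup>i\<close> is its value at the \<open>i\<close>-th unit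
  vector; see \<open>symbol_of_lambda_nu_system\<close> below.\<close>

definition lambda_nu_system ::
  "(real \<times> real \<Rightarrow> real) \<Rightarrow> (real \<times> real \<Rightarrow> real) \<Rightarrow> (real \<times> real \<Rightarrow> real) \<Rightarrow>
   (real \<times> real \<Rightarrow> real) \<Rightarrow> (real \<times> real \<Rightarrow> real) \<Rightarrow> real \<Rightarrow> quasilinear_system" where
  "lambda_nu_system p e \<kappa> lam nu \<tau> =
    \<lparr> time_coeff = A0_matrix e \<tau>,
      space_coeff = (\<lambda>i. A_symbol p e \<kappa> lam nu \<tau> (axis i 1)),
      source = (\<lambda>(\<rho>, v, \<theta>, q). \<chi> i. case i of Flux k \<Rightarrow> q $ k | _ \<Rightarrow> 0) \<rparr>"

lemma Q_matrix_linear: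
  "Q_matrix lam nu \<xi> q $ k $ l = (\<Sum>i\<in>UNIV. \<xi> $ i * Q_matrix lam nu (axis i 1) q $ k $ l)"
proof -
  have axis: "axis (1::3) (1::real) $ 1 = 1" "axis (1::3) (1::real) $ 2 = 0"
    "axis (1::3) (1::real) $ 3 = 0" "axis (2::3) (1::real) $ 1 = 0"
    "axis (2::3) (1::real) $ 2 = 1" "axis (2::3) (1::real) $ 3 = 0"
    "axis (3::3) (1::real) $ 1 = 0" "axis (3::3) (1::real) $ 2 = 0"
    "axis (3::3) (1::real) $ 3 = 1"
    by (simp_all add: axis_def)
  have "\<forall>k l. Q_matrix lam nu \<xi> q $ k $ l
          = (\<Sum>i\<in>UNIV. \<xi> $ i * Q_matrix lam nu (axis i 1) q $ k $ l)"
    unfolding forall_3 sum_3 Q_matrix_def Let_def vector_3 axis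
    by (intro conjI) algebra+
  then show ?thesis by blast
qed

lemma symbol_of_lambda_nu_system:
  "symbol_of (lambda_nu_system p e \<kappa> lam nu \<tau>) \<xi> U = A_symbol p e \<kappa> lam nu \<tau> \<xi> U"
proof -
  obtain \<rho> v \<theta> q where U: "U = (\<rho>, v, \<theta>, q)" by (cases U) auto
  have inner: "(\<Sum>i\<in>UNIV. \<xi> $ i * (axis i 1 \<bullet> v)) = \<xi> \<bullet> v"
    by (simp only: inner_vec_def[of \<xi>] inner_axis' inner_real_def mult_1)
  have comp: "(\<Sum>i\<in>UNIV. \<xi> $ i * axis i 1 $ k) = \<xi> $ k" for k
    by (simp add: axis_def mult_delta_right)
  have pull: "(\<Sum>i\<in>UNIV. \<xi> $ i * (c * f i)) = c * (\<Sum>i\<in>UNIV. \<xi> $ i * f i)"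
    "(\<Sum>i\<in>UNIV. \<xi> $ i * (c * f i * d)) = c * (\<Sum>i\<in>UNIV. \<xi> $ i * f i) * d"
    for c d :: real and f :: "3 \<Rightarrow> real"
    unfolding sum_distrib_left sum_distrib_right by (rule sum.cong; simp)+
  show ?thesis
    unfolding vec_eq_iff
  proof (intro allI)
    fix a b
    show "symbol_of (lambda_nu_system p e \<kappa> lam nu \<tau>) \<xi> U $ a $ b
            = A_symbol p e \<kappa> lam nu \<tau> \<xi> U $ a $ b"
      unfolding symbol_of_def lambda_nu_system_def A_symbol_def U
      by (cases a; cases b)
         (simp_all add: inner comp pull Q_matrix_linear[symmetric])
  qed
qed

end

theory Submission
  imports Defs "HOL-Computational_Algebra.Fundamental_Theorem_Algebra"
begin

text \<open>Take \<open>v = 0\<close> and let both \<open>\<xi>\<close> and \<open>q\<close> point in the first coordinate direction. Eliminating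
  the other components of a longitudinal eigenvector with eigenvalue \<open>\<eta> \<noteq> 0\<close> leaves a quartic in
  \<open>\<eta>\<close> without cubic term, whose quadratic coefficient does not depend on \<open>q\<close> and whose linear
  coefficient is a nonzero multiple of \<open>(\<lambda> + \<nu>) q\<^sub>1\<close>. If all roots were real, the quadratic
  coefficient would bound the sum of their squares, hence the sum of their cubes, which is
  proportional to the linear coefficient; so for suitable \<open>q\<^sub>1\<close> there is a nonreal root.\<close>

text \<open>Only the power sums of degree 1 to 3 of the roots enter the argument, and these do not
  involve the constant term; hence \<open>d\<close> is arbitrary.\<close>

lemma depressed_quartic_nonreal_root:
  fixes b c d :: real
  assumes "b \<ge> 0" and c: "3 * c > 2 * b * (1 + 2 * b)"
  shows "\<exists>z. z \<notin> \<real> \<and> z ^ 4 - of_real b * z ^ 2 - of_real c * z + of_real d = (0 :: complex)"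
proof (rule ccontr)
  assume "\<not> ?thesis"
  then have real: "z \<in> \<real>"
    if "z ^ 4 - of_real b * z ^ 2 - of_real c * z + of_real d = 0" for z :: complex
    using that by blast
  define P :: "complex poly" where "P = [:of_real d, - of_real c, - of_real b, 0, 1:]"
  have poly_P: "poly P z = z ^ 4 - of_real b * z ^ 2 - of_real c * z + of_real d" for z
    by (simp add: P_def algebra_simps power2_eq_square power4_eq_xxxx)
  have "degree P = 4"
    by (simp add: P_def)
  obtain A where A: "size A = degree P" "P = smult (lead_coeff P) (\<Prod>x\<in>#A. [:- x, 1:])"
    using alg_closed_imp_factorization[of P] \<open>degree P = 4\<close> by force
  obtain x y z w where xyzw: "A = {#x, y, z, w#}"
  proof -
    obtain xs where xs: "mset xs = A" using ex_mset by blast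
    then have "length xs = 4"
      using A(1) \<open>degree P = 4\<close> by auto
    then obtain x y z w where "xs = [x, y, z, w]"
      by (auto simp: numeral_eq_Suc length_Suc_conv)
    with xs show thesis by (auto intro: that)
  qed
  have P_eq: "P = [:- x, 1:] * [:- y, 1:] * [:- z, 1:] * [:- w, 1:]"
  proof -
    have "lead_coeff P = 1"
      by (simp add: P_def)
    then have "P = (\<Prod>x\<in>#A. [:- x, 1:])"
      using A(2) by (metis smult_1_left)
    then show ?thesis
      by (simp only: xyzw image_mset_add_mset prod_mset.add_mset image_mset_empty prod_mset_empty
          mult_1_right mult.assoc)
  qed
  have "poly P x = 0" "poly P y = 0" "poly P z = 0" "poly P w = 0"
    unfolding P_eq poly_mult by simp_all
  then have "x \<in> \<real>" "y \<in> \<real>" "z \<in> \<real>" "w \<in> \<real>"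
    using real by (simp_all add: poly_P)
  then obtain x' y' z' w' :: real where
    roots: "x = of_real x'" "y = of_real y'" "z = of_real z'" "w = of_real w'"
    unfolding Reals_def by blast
  \<comment> \<open>Vieta's formulas: comparing coefficients gives the elementary symmetric
    functions 0, \<open>- b\<close> and \<open>c\<close> of the roots.\<close>
  have "[:of_real d, - of_real c, - of_real b, 0, 1:] =
    [:x * y * z * w, - (x * y * z + x * y * w + x * z * w + y * z * w),
      x * y + x * z + x * w + y * z + y * w + z * w, - (x + y + z + w), 1:]"
    unfolding P_def[symmetric] P_eq by (simp add: algebra_simps)
  then have "complex_of_real (x' + y' + z' + w') = of_real 0"
    "complex_of_real (x' * y' + x' * z' + x' * w' + y' * z' + y' * w' + z' * w') = of_real (- b)"
    "complex_of_real (x' * y' * z' + x' * y' * w' + x' * z' * w' + y' * z' * w') = of_real c"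
    unfolding pCons_eq_iff neg_equal_iff_equal roots of_real_add of_real_mult of_real_minus of_real_0
    by (elim conjE; simp only: neg_0_equal_iff_equal)+
  then have e: "x' + y' + z' + w' = 0"
    "x' * y' + x' * z' + x' * w' + y' * z' + y' * w' + z' * w' = - b"
    "x' * y' * z' + x' * y' * w' + x' * z' * w' + y' * z' * w' = c"
    unfolding of_real_eq_iff .
  \<comment> \<open>Newton's identities convert these into power sums. As the roots sum to 0, the
    squares sum to \<open>2 * b\<close> and the cubes to \<open>3 * c\<close>.\<close>
  have "x'\<^sup>2 + y'\<^sup>2 + z'\<^sup>2 + w'\<^sup>2 = (x' + y' + z' + w')\<^sup>2
      - 2 * (x' * y' + x' * z' + x' * w' + y' * z' + y' * w' + z' * w')"
    by (simp add: algebra_simps power2_eq_square)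
  then have squares: "x'\<^sup>2 + y'\<^sup>2 + z'\<^sup>2 + w'\<^sup>2 = 2 * b"
    unfolding e by simp
  have "x' ^ 3 + y' ^ 3 + z' ^ 3 + w' ^ 3 = (x' + y' + z' + w') * ((x'\<^sup>2 + y'\<^sup>2 + z'\<^sup>2 + w'\<^sup>2)
        - (x' * y' + x' * z' + x' * w' + y' * z' + y' * w' + z' * w'))
      + 3 * (x' * y' * z' + x' * y' * w' + x' * z' * w' + y' * z' * w')"
    by (simp add: algebra_simps power3_eq_cube power2_eq_square)
  then have cubes: "x' ^ 3 + y' ^ 3 + z' ^ 3 + w' ^ 3 = 3 * c"
    unfolding e by simp
  \<comment> \<open>A bound for \<open>sqrt (2 * b)\<close> that is polynomial in \<open>b\<close>.
    Pulling one factor out of each cube bounds the cube sum by \<open>M * (2 * b)\<close>, which is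
    the threshold in the hypothesis on \<open>c\<close>.\<close>
  define M where "M = 1 + 2 * b"
  have bound: "r ^ 3 \<le> M * r\<^sup>2" if "r\<^sup>2 \<le> 2 * b" for r :: real
  proof -
    have "M\<^sup>2 = 1 + 2 * (2 * b) + (2 * b)\<^sup>2"
      unfolding M_def power2_sum by simp
    then have "r\<^sup>2 \<le> M\<^sup>2"
      using that assms(1) zero_le_power2[of "2 * b"] by linarith
    then have "r \<le> M"
      by (rule power2_le_imp_le) (use assms(1) in \<open>simp add: M_def\<close>)
    moreover have "r ^ 3 = r * r\<^sup>2"
      by (simp add: power3_eq_cube power2_eq_square)
    ultimately show ?thesis
      by (simp only: mult_right_mono zero_le_power2)
  qed
  have "x'\<^sup>2 \<le> 2 * b" "y'\<^sup>2 \<le> 2 * b" "z'\<^sup>2 \<le> 2 * b" "w'\<^sup>2 \<le> 2 * b"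
    using squares zero_le_power2[of x'] zero_le_power2[of y'] zero_le_power2[of z']
      zero_le_power2[of w'] by linarith+
  from this[THEN bound]
  have "x' ^ 3 + y' ^ 3 + z' ^ 3 + w' ^ 3 \<le> M * x'\<^sup>2 + M * y'\<^sup>2 + M * z'\<^sup>2 + M * w'\<^sup>2"
    by (intro add_mono)
  then have "3 * c \<le> M * (2 * b)"
    unfolding cubes squares[symmetric] distrib_left .
  with c show False
    by (simp add: M_def mult.commute)
qed

lemma sum_component:
  "(\<Sum>j\<in>UNIV. f j) = f Density + f Temperature + (\<Sum>k\<in>UNIV. f (Velocity k)) + (\<Sum>k\<in>UNIV. f (Flux k))"
  for f :: "component \<Rightarrow> 'a::comm_monoid_add"
proof -
  have "(\<Sum>j\<in>UNIV. f j) = sum f ({Density, Temperature} \<union> range Velocity) + sum f (range Flux)"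
    unfolding UNIV_component by (rule sum.union_disjoint) auto
  also have "sum f ({Density, Temperature} \<union> range Velocity) = f Density + f Temperature + sum f (range Velocity)"
    by (subst sum.union_disjoint) auto
  finally show ?thesis
    by (simp add: sum.reindex inj_on_def)
qed

lemma gen_eigenvector_iff:
  "gen_eigenvector A B \<eta> V \<longleftrightarrow> V \<noteq> 0 \<and> A *v V = \<eta> *s (B *v V)"
proof -
  have "(mat \<eta> ** B) *v V = \<eta> *s (B *v V)"
    unfolding matrix_vector_mul_assoc[symmetric]
    by (simp add: vec_eq_iff mat_def matrix_vector_mult_def if_distrib[of "\<lambda>x. x * _"] cong: if_cong)
  then show ?thesis
    by (simp add: gen_eigenvector_def matrix_vector_mult_diff_rdistrib)
qed

theorem theorem5p1:
  fixes p e \<kappa> lam nu :: "real \<times> real \<Rightarrow> real" and \<tau> :: real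
  assumes "smooth_on p thermo_domain" and "smooth_on e thermo_domain"
    and "smooth_on \<kappa> thermo_domain"
    and "\<And>x. x \<in> thermo_domain \<Longrightarrow> p x > 0"
    and "\<And>x. x \<in> thermo_domain \<Longrightarrow> d_rho p x > 0"
    and "\<And>x. x \<in> thermo_domain \<Longrightarrow> d_theta p x > 0"
    and "\<And>x. x \<in> thermo_domain \<Longrightarrow> d_theta e x > 0"
    and "\<And>x. x \<in> thermo_domain \<Longrightarrow> \<kappa> x > 0"
    and "\<tau> > 0"
    and "\<exists>x\<in>thermo_domain. lam x + nu x \<noteq> 0"
  shows "\<not> hyperbolic (lambda_nu_system p e \<kappa> lam nu \<tau>)"
proof
  let ?S = "lambda_nu_system p e \<kappa> lam nu \<tau>"
  assume hyp: "hyperbolic ?S"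
  obtain \<rho> \<theta> where dom: "(\<rho>, \<theta>) \<in> thermo_domain" and \<gamma>: "lam (\<rho>, \<theta>) + nu (\<rho>, \<theta>) \<noteq> 0"
    using assms(10) by auto
  define pr pt et k where
    "pr = d_rho p (\<rho>, \<theta>)" and "pt = d_theta p (\<rho>, \<theta>)" and "et = d_theta e (\<rho>, \<theta>)" and "k = \<kappa> (\<rho>, \<theta>)"
  have pos: "\<rho> > 0" "\<theta> > 0" "pr > 0" "pt > 0" "et > 0" "k > 0" "\<tau> > 0"
    using dom assms(5-9) by (auto simp: thermo_domain_def pr_def pt_def et_def k_def)
  \<comment> \<open>The determinant of \<open>A - \<eta> B\<close> on the longitudinal components
    (density, first velocity, temperature, first flux) is \<open>a\<close> times the quartic with
    coefficients \<open>b\<close>, \<open>c\<close>, \<open>d\<close>.\<close>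
  define a where "a = \<tau> * \<rho>\<^sup>2 * et"
  define b where "b = (\<rho> * k + \<tau> * \<rho>\<^sup>2 * et * pr + \<tau> * \<theta> * pt\<^sup>2) / a"
  \<comment> \<open>Since \<open>b\<close> does not involve the heat flux, \<open>c\<close> can be
    put above the threshold first and the flux fitted to it afterwards.\<close>
  define c where "c = 1 + 2 * b * (1 + 2 * b)"
  define d where "d = \<rho> * pr * k / a"
  \<comment> \<open>\<open>\<beta>\<close> is the value that the (1,1) entry of the Q matrix must
    take to produce the linear coefficient \<open>c\<close>. That entry is
    \<open>\<lambda> + \<nu>\<close> times the first flux component, so the flux \<open>s\<close>
    attains it; here the hypothesis \<open>\<gamma>\<close> is used.\<close>
  define \<beta> where "\<beta> = a * c / (\<tau> * pt)"
  define s where "s = \<beta> / (lam (\<rho>, \<theta>) + nu (\<rho>, \<theta>))"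
  have "a > 0" using pos by (simp add: a_def)
  have "b \<ge> 0" using pos \<open>a > 0\<close> by (simp add: b_def)
  then have "3 * c > 2 * b * (1 + 2 * b)"
    by (simp add: c_def algebra_simps add_pos_nonneg)
  with \<open>b \<ge> 0\<close> obtain \<eta> :: complex where "\<eta> \<notin> \<real>"
    and root: "\<eta> ^ 4 - of_real b * \<eta>\<^sup>2 - of_real c * \<eta> + of_real d = 0"
    using depressed_quartic_nonreal_root by blast
  from \<open>\<eta> \<notin> \<real>\<close> have "\<eta> \<noteq> 0" by auto
  have ab: "a * b = \<rho> * k + \<tau> * \<rho>\<^sup>2 * et * pr + \<tau> * \<theta> * pt\<^sup>2" and ac: "a * c = \<tau> * pt * \<beta>"
    and ad: "a * d = \<rho> * pr * k"
    using \<open>a > 0\<close> pos by (simp_all add: b_def \<beta>_def d_def)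
  have "of_real a * \<eta> ^ 4 - of_real (a * b) * \<eta>\<^sup>2 - of_real (a * c) * \<eta>
      + of_real (a * d) = of_real a * 0"
    unfolding root[symmetric] by (simp add: algebra_simps)
  then have quartic: "of_real (\<tau> * \<rho>\<^sup>2 * et) * \<eta> ^ 4
      - of_real (\<rho> * k + \<tau> * \<rho>\<^sup>2 * et * pr + \<tau> * \<theta> * pt\<^sup>2) * \<eta>\<^sup>2
      - of_real (\<tau> * pt * \<beta>) * \<eta> + of_real (\<rho> * pr * k) = 0"
    unfolding ab ac ad unfolding a_def mult_zero_right .
  define U :: state where "U = (\<rho>, 0, \<theta>, axis 1 s)"
  have "U \<in> state_domain"
    using pos by (simp add: U_def state_domain_def)
  \<comment> \<open>With density \<open>\<rho> * pt\<close> and first velocity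
    \<open>pt * \<eta>\<close> the density row holds. The velocity row then forces the temperature
    \<open>t\<close>, and the flux row, solved using \<open>\<eta> \<noteq> 0\<close>, forces the
    flux \<open>z\<close>.\<close>
  define t where "t = of_real \<rho> * (\<eta>\<^sup>2 - of_real pr)"
  define z where "z = (of_real (\<tau> * \<beta> * pt) * \<eta> + of_real k * t) / (of_real \<tau> * \<eta>)"
  define V :: "complex^component" where
    "V = (\<chi> i. case i of Density \<Rightarrow> of_real (\<rho> * pt) | Velocity l \<Rightarrow> if l = 1 then of_real pt * \<eta> else 0
        | Temperature \<Rightarrow> t | Flux l \<Rightarrow> if l = 1 then z else 0)"
  have z1: "of_real \<tau> * \<eta> * z = of_real (\<tau> * \<beta> * pt) * \<eta> + of_real k * t"
    using pos \<open>\<eta> \<noteq> 0\<close> by (simp add: z_def)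
  \<comment> \<open>The remaining row, temperature, becomes exactly the quartic after multiplication
    by \<open>\<tau> * \<eta>\<close>.\<close>
  have "of_real \<tau> * \<eta> * (\<eta> * of_real (\<rho> * et) * t)
      - of_real \<tau> * \<eta> * (of_real (\<theta> * pt\<^sup>2) * \<eta> + z) = 0"
    unfolding distrib_left z1 quartic[symmetric] t_def
    by (simp add: algebra_simps power2_eq_square power4_eq_xxxx)
  then have z2: "of_real (\<theta> * pt\<^sup>2) * \<eta> + z = \<eta> * of_real (\<rho> * et) * t"
    using pos \<open>\<eta> \<noteq> 0\<close> by simp
  have rows: "of_real pr * (of_real \<rho> * of_real pt) + of_real pt * t = \<eta> * (of_real \<rho> * (of_real pt * \<eta>))"
    "of_real \<theta> * of_real pt * (of_real pt * \<eta>) + z = \<eta> * (of_real \<rho> * of_real et * t)"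
    "of_real k * t + of_real \<tau> * of_real \<beta> * (of_real pt * \<eta>) = \<eta> * (of_real \<tau> * z)"
    using z1 z2 by (simp_all add: t_def algebra_simps power2_eq_square)
  let ?A = "map_matrix complex_of_real (symbol_of ?S (axis 1 1) U)"
  let ?B = "map_matrix complex_of_real (time_coeff ?S U)"
  have "V $ Density \<noteq> 0"
    using pos by (simp add: V_def)
  then have "V \<noteq> 0" by auto
  moreover have "?A *v V = \<eta> *s (?B *v V)"
    unfolding vec_eq_iff
  proof
    fix i
    \<comment> \<open>Only the first column matters, because the velocity part of \<open>V\<close>
      is longitudinal. Its transverse entries vanish as \<open>\<xi>\<close> and \<open>q\<close>
      are parallel to the first axis, so the transverse flux rows are trivial.\<close>
    have Q: "Q_matrix (lam (\<rho>, \<theta>)) (nu (\<rho>, \<theta>)) (axis 1 1) (axis 1 s) $ l $ 1 = (if l = 1 then \<beta> else 0)" for l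
      using \<gamma> exhaust_3[of l] by (auto simp: Q_matrix_def Let_def vector_3 axis_def s_def)
    have A0: "time_coeff ?S = A0_matrix e \<tau>"
      by (simp add: lambda_nu_system_def)
    have axis: "axis 1 1 $ l = (if l = 1 then 1 else 0 :: real)" for l :: 3
      by (simp add: axis_def)
    show "(?A *v V) $ i = (\<eta> *s (?B *v V)) $ i"
      unfolding symbol_of_lambda_nu_system A0
      using rows
      by (cases i) (simp_all add: matrix_vector_mult_def sum_component V_def U_def A_symbol_def
          A0_matrix_def map_matrix_def sum_3 Q axis flip: pr_def pt_def et_def k_def)
  qed
  ultimately have "gen_eigenvector ?A ?B \<eta> V"
    by (simp add: gen_eigenvector_iff)
  moreover have "axis 1 1 \<in> sphere (0 :: real^3) 1"
    by simp
  ultimately show False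
    using hyp \<open>U \<in> state_domain\<close> \<open>\<eta> \<notin> \<real>\<close> unfolding hyperbolic_def Let_def by blast
qed

end
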